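(* Let $X,\nu,R,M_p,M_p^*$ be as in the context, with $R\nabla$ closable in $L^p(X,\nu)$ for every $p\in(1,\infty)$, and let $g:X\to\mathbb{R}$ be a Borel function such that, for every $p>1$, $g\in W^{1,p}(X,\nu)$ and $Mg\,\|Mg\|^{-2}\in D(M_p^* )$. Let $g^*$ be a $C_p$-quasicontinuous version of $g$ for some $p>1$. Then for every $r_0\in\mathbb{R}$ the support of $\sigma_{r_0}^g$ is contained in $(g^* )^{-1}(r_0)$, in the sense that $X\setminus (g^* )^{-1}(r_0)$ is $\sigma_{r_0}^g$-negligible.
   Context: $X$ is a separable infinite-dimensional real Hilbert space with inner product $\langle\cdot,\cdot\rangle$ and norm $\|\cdot\|$, and $\nu$ is a non-degenerate Borel probability measure on $X$ (non-degenerate: not concentrated on any proper closed linear subspace). $C_b(X)$ is the space of bounded continuous real functions; $C_b^1(X)$ is the space of bounded continuously Fréchet differentiable $\varphi:X\to\mathbb{R}$ with bounded gradient $\nabla\varphi$. $R\in\mathcal{L}(X)$ is a bounded linear operator such that for every $p\in(1,\infty)$ the operator $\varphi\mapsto R\nabla\varphi$, with domain $C^1_b(X)\subset L^p(X,\nu)$ and values in $L^p(X,\nu;X)$, is closable. $M_p$ denotes its closure, $W^{1,p}(X,\nu)$ the domain of $M_p$, with norm $\|f\|_{W^{1,p}}=\|f\|_{L^p(X,\nu)}+\|M_pf\|_{L^p(X,\nu;X)}$. With $p'=p/(p-1)$, $M_p^*:D(M_p^* )\subset L^{p'}(X,\nu;X)\to L^{p'}(X,\nu)$ is the adjoint of $M_p$.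 One writes $M$, $M^*$ on $\bigcap_{p>1}W^{1,p}(X,\nu)$, $\bigcap_{p>1}D(M_p^* )$, where the operators do not depend on $p$. The condition on $Mg\,\|Mg\|^{-2}$ includes that it is defined $\nu$-a.e. For $r\in\mathbb{R}$, $\sigma_r^g$ is the unique finite nonnegative Borel measure on $X$ such that $\int_X\varphi\,d\sigma_r^g=\frac{d}{dr}\int_{\{g\le r\}}\varphi\,d\nu$ for every $\varphi\in C_b(X)$ (the derivatives and the measure exist whenever $R\nabla$ is closable in $L^p(X,\nu)$ for every $p\in(1,\infty)$ and $g:X\to\mathbb{R}$ is a Borel function such that $g\in W^{1,p}(X,\nu)$ and $Mg\,\|Mg\|^{-2}\in D(M_p^* )$ for every $p>1$). A set is $\sigma_r^g$-negligible if it is contained in a Borel set of $\sigma_r^g$-measure zero. Capacity: for $O\subset X$ open, $C_p(O)=\inf\{\|f\|_{W^{1,p}(X,\nu)}: f\in W^{1,p}(X,\nu),\ f\ge \mathbf{1}_O\ \nu\text{-a.e.}\}$. A function $f:X\to\mathbb{R}$ is $C_p$-quasicontinuous if for every $\varepsilon>0$ there is an open set $O$ with $C_p(O)<\varepsilon$ such that the restriction of $f$ to $X\setminus O$ is continuous. A version of $g$ is a function equal to $g$ $\nu$-a.e. *)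

theory Defs
  imports "HOL-Probability.Probability"
begin

text \<open>
  Elements of Lebesgue and Sobolev spaces are functions, with almost everywhere equality
  in place of the quotient; an unbounded operator is given by its graph, which is closed
  under measurable almost everywhere modification.
\<close>

definition infinite_dimensional :: "'a::real_vector itself \<Rightarrow> bool" where
  "infinite_dimensional _ \<longleftrightarrow> \<not> (\<exists>B::'a set. finite B \<and> span B = UNIV)"

definition nondegenerate :: "'a::real_normed_vector measure \<Rightarrow> bool" where
  "nondegenerate \<nu> \<longleftrightarrow>
     (\<forall>V. subspace V \<and> closed V \<and> V \<noteq> UNIV \<longrightarrow> emeasure \<nu> V \<noteq> 1)"

definition Lp :: "'a measure \<Rightarrow> real \<Rightarrow> ('a \<Rightarrow> 'b::{real_normed_vector, second_countable_topology}) set" where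
  "Lp \<nu> p = {f \<in> borel_measurable \<nu>. integrable \<nu> (\<lambda>x. norm (f x) powr p)}"

definition Lp_norm :: "'a measure \<Rightarrow> real \<Rightarrow> ('a \<Rightarrow> 'b::{real_normed_vector, second_countable_topology}) \<Rightarrow> real" where
  "Lp_norm \<nu> p f = (\<integral>x. norm (f x) powr p \<partial>\<nu>) powr (1 / p)"

definition Cb :: "('a::topological_space \<Rightarrow> real) set" where
  "Cb = {\<phi>. continuous_on UNIV \<phi> \<and> bounded (range \<phi>)}"

definition grad :: "('a::real_inner \<Rightarrow> real) \<Rightarrow> 'a \<Rightarrow> 'a" where
  "grad \<phi> x = (THE d. GDERIV \<phi> x :> d)"

text \<open>
  On a Hilbert space every Frechet derivative into the reals is represented by a gradient,
  isometrically, so continuity of the derivative is continuity of the gradient.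
\<close>

definition Cb1 :: "('a::real_inner \<Rightarrow> real) set" where
  "Cb1 = {\<phi> \<in> Cb. (\<forall>x. \<exists>d. GDERIV \<phi> x :> d) \<and>
            continuous_on UNIV (grad \<phi>) \<and> bounded (range (grad \<phi>))}"

text \<open>
  The closure in \<open>L\<^sup>p \<times> L\<^sup>p\<close> of the graph of \<open>\<phi> \<mapsto> R (grad \<phi>)\<close> on \<open>Cb1\<close>.
\<close>

definition M_graph ::
  "'a::{real_inner, polish_space} measure \<Rightarrow> ('a \<Rightarrow> 'a) \<Rightarrow> real \<Rightarrow> (('a \<Rightarrow> real) \<times> ('a \<Rightarrow> 'a)) set" where
  "M_graph \<nu> R p = {(f, F). f \<in> Lp \<nu> p \<and> F \<in> Lp \<nu> p \<and>
     (\<exists>\<phi>. (\<forall>n::nat. \<phi> n \<in> Cb1) \<and>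
        (\<lambda>n. Lp_norm \<nu> p (\<lambda>x. \<phi> n x - f x)) \<longlonglongrightarrow> 0 \<and>
        (\<lambda>n. Lp_norm \<nu> p (\<lambda>x. R (grad (\<phi> n) x) - F x)) \<longlonglongrightarrow> 0)}"

definition closable_R_grad ::
  "'a::{real_inner, polish_space} measure \<Rightarrow> ('a \<Rightarrow> 'a) \<Rightarrow> real \<Rightarrow> bool" where
  "closable_R_grad \<nu> R p \<longleftrightarrow>
     (\<forall>f F G. (f, F) \<in> M_graph \<nu> R p \<and> (f, G) \<in> M_graph \<nu> R p \<longrightarrow> (AE x in \<nu>. F x = G x))"

definition W1 :: "'a::{real_inner, polish_space} measure \<Rightarrow> ('a \<Rightarrow> 'a) \<Rightarrow> real \<Rightarrow> ('a \<Rightarrow> real) set" where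
  "W1 \<nu> R p = Domain (M_graph \<nu> R p)"

text \<open>A representative; it is unique almost everywhere when \<open>closable_R_grad \<nu> R p\<close>.\<close>

definition M_op ::
  "'a::{real_inner, polish_space} measure \<Rightarrow> ('a \<Rightarrow> 'a) \<Rightarrow> real \<Rightarrow> ('a \<Rightarrow> real) \<Rightarrow> 'a \<Rightarrow> 'a" where
  "M_op \<nu> R p f = (SOME F. (f, F) \<in> M_graph \<nu> R p)"

definition W1_norm ::
  "'a::{real_inner, polish_space} measure \<Rightarrow> ('a \<Rightarrow> 'a) \<Rightarrow> real \<Rightarrow> ('a \<Rightarrow> real) \<Rightarrow> real" where
  "W1_norm \<nu> R p f = Lp_norm \<nu> p f + Lp_norm \<nu> p (M_op \<nu> R p f)"

text \<open>The graph and the domain of the adjoint, with \<open>L\<^sup>p\<close> in duality with \<open>L\<^sup>q\<close>, \<open>q = p / (p - 1)\<close>.\<close>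

definition M_adj_graph ::
  "'a::{real_inner, polish_space} measure \<Rightarrow> ('a \<Rightarrow> 'a) \<Rightarrow> real \<Rightarrow> (('a \<Rightarrow> 'a) \<times> ('a \<Rightarrow> real)) set" where
  "M_adj_graph \<nu> R p = {(F, h). F \<in> Lp \<nu> (p / (p - 1)) \<and> h \<in> Lp \<nu> (p / (p - 1)) \<and>
     (\<forall>f \<in> W1 \<nu> R p. (\<integral>x. M_op \<nu> R p f x \<bullet> F x \<partial>\<nu>) = (\<integral>x. f x * h x \<partial>\<nu>))}"

definition M_adj_dom ::
  "'a::{real_inner, polish_space} measure \<Rightarrow> ('a \<Rightarrow> 'a) \<Rightarrow> real \<Rightarrow> ('a \<Rightarrow> 'a) set" where
  "M_adj_dom \<nu> R p = Domain (M_adj_graph \<nu> R p)"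

text \<open>\<open>\<sigma>\<close> is the surface measure on the level set \<open>{g = r}\<close>; at most one \<open>\<sigma>\<close> satisfies this.\<close>

definition is_surface_measure ::
  "'a::metric_space measure \<Rightarrow> ('a \<Rightarrow> real) \<Rightarrow> real \<Rightarrow> 'a measure \<Rightarrow> bool" where
  "is_surface_measure \<nu> g r \<sigma> \<longleftrightarrow> finite_measure \<sigma> \<and> sets \<sigma> = sets borel \<and>
     (\<forall>\<phi> \<in> Cb. ((\<lambda>s. LINT x:{x. g x \<le> s}|\<nu>. \<phi> x) has_real_derivative (\<integral>x. \<phi> x \<partial>\<sigma>)) (at r))"

text \<open>The constant function 1 is always admissible, so the infimum is over a nonempty set.\<close>

definition capacity ::
  "'a::{real_inner, polish_space} measure \<Rightarrow> ('a \<Rightarrow> 'a) \<Rightarrow> real \<Rightarrow> 'a set \<Rightarrow> real" where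
  "capacity \<nu> R p U = Inf {W1_norm \<nu> R p f | f.
     f \<in> W1 \<nu> R p \<and> (AE x in \<nu>. f x \<ge> indicator U x)}"

definition quasicontinuous ::
  "'a::{real_inner, polish_space} measure \<Rightarrow> ('a \<Rightarrow> 'a) \<Rightarrow> real \<Rightarrow> ('a \<Rightarrow> real) \<Rightarrow> bool" where
  "quasicontinuous \<nu> R p f \<longleftrightarrow>
     (\<forall>\<epsilon>>0. \<exists>U. open U \<and> capacity \<nu> R p U < \<epsilon> \<and> continuous_on (- U) f)"

end

theory Submission
  imports Defs
begin

text \<open>
  The surface measure of an open set is at most a constant times its capacity; everything
  else is soft.

  Write \<open>\<Psi> = Mg / \<parallel>Mg\<parallel>\<^sup>2\<close> and \<open>h\<close> for the image of \<open>\<Psi>\<close> under the adjoint of \<open>M\<close>, so that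
  \<open>Mg \<bullet> \<Psi> = 1\<close> almost everywhere. Testing the adjoint relation on \<open>\<theta>(g) f\<close> and using the
  product and chain rules gives

    \<open>\<integral> \<theta>'(g) f d\<nu> = \<integral> \<theta>(g) (f h - Mf \<bullet> \<Psi>) d\<nu>\<close>

  for every \<open>f\<close> in the Sobolev space (\<open>integration_by_parts\<close>). The right-hand side is at most
  \<open>sup \<bar>\<theta>\<bar>\<close> times a fixed multiple of the Sobolev norm of \<open>f\<close>, by Hoelder's inequality.
  Rescaling a bounded increasing \<open>\<theta>\<close> around the level \<open>r\<close> makes \<open>\<theta>'(g)\<close> dominate,
  up to a factor, the normalised indicator of a thin strip \<open>{r < g \<le> r + \<delta>}\<close>, which bounds the average of a
  nonnegative \<open>f\<close> over the strip by its Sobolev norm, uniformly in \<open>\<delta>\<close> (\<open>level_strip_le\<close>).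
  In the limit \<open>\<delta> \<rightarrow> 0\<close> this bounds \<open>\<integral> \<phi> d\<sigma>\<close> by the norm of \<open>f\<close> as soon as \<open>\<phi> \<le> f\<close> almost
  everywhere on some strip (\<open>surface_integral_le\<close>). Here \<open>f\<close> may be an arbitrary nonnegative
  Sobolev function, which is what the definition of capacity supplies.

  Let \<open>U\<close> be an open set of capacity below \<open>\<epsilon>\<close> off which \<open>gstar\<close> is continuous. For \<open>\<eta> > 0\<close>
  the set \<open>U \<union> {\<bar>gstar - r\<bar> > \<eta>}\<close> is open, and inside a strip of width \<open>\<eta>\<close> it coincides with
  \<open>U\<close> up to a \<open>\<nu>\<close>-null set, because \<open>gstar = g\<close> almost everywhere. Its surface measure is
  therefore at most a constant times \<open>\<epsilon>\<close>, with a constant that does not depend on \<open>\<eta>\<close>. Let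
  \<open>\<eta> \<rightarrow> 0\<close> and then \<open>\<epsilon> \<rightarrow> 0\<close>.
\<close>

section \<open>Lebesgue spaces\<close>

lemma Lp_dominated:
  assumes G: "G \<in> Lp M p" and F: "F \<in> borel_measurable M" and p: "p > 0"
    and le: "\<And>x. norm (F x) \<le> B * norm (G x)" and B: "B \<ge> 0"
  shows "F \<in> Lp M p"
proof -
  have G_int: "integrable M (\<lambda>x. norm (G x) powr p)"
    using G by (auto simp: Lp_def)
  have "integrable M (\<lambda>x. B powr p * norm (G x) powr p)"
    by (intro integrable_mult_right G_int)
  then have "integrable M (\<lambda>x. norm (F x) powr p)"
  proof (rule Bochner_Integration.integrable_bound)
    show "(\<lambda>x. norm (F x) powr p) \<in> borel_measurable M"
      using F by measurable
    show "AE x in M. norm (norm (F x) powr p) \<le> norm (B powr p * norm (G x) powr p)"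
    proof (rule AE_I2)
      fix x
      have "norm (F x) powr p \<le> (B * norm (G x)) powr p"
        by (intro powr_mono2) (use p le in auto)
      then show "norm (norm (F x) powr p) \<le> norm (B powr p * norm (G x) powr p)"
        using B by (simp add: powr_mult)
    qed
  qed
  with F show ?thesis
    by (simp add: Lp_def)
qed

lemma Lp_diff:
  assumes F: "F \<in> Lp M p" and G: "G \<in> Lp M p" and p: "p > 0"
  shows "(\<lambda>x. F x - G x) \<in> Lp M p"
proof -
  have F_meas [measurable]: "F \<in> borel_measurable M"
    and F_int: "integrable M (\<lambda>x. norm (F x) powr p)"
    using F by (auto simp: Lp_def)
  have G_meas [measurable]: "G \<in> borel_measurable M"
    and G_int: "integrable M (\<lambda>x. norm (G x) powr p)"
    using G by (auto simp: Lp_def)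
  have "integrable M (\<lambda>x. 2 powr p * (norm (F x) powr p + norm (G x) powr p))"
    by (intro integrable_mult_right Bochner_Integration.integrable_add F_int G_int)
  then have "integrable M (\<lambda>x. norm (F x - G x) powr p)"
  proof (rule Bochner_Integration.integrable_bound)
    show "AE x in M. norm (norm (F x - G x) powr p)
        \<le> norm (2 powr p * (norm (F x) powr p + norm (G x) powr p))"
    proof (rule AE_I2)
      fix x
      have "norm (F x - G x) powr p \<le> (2 * max (norm (F x)) (norm (G x))) powr p"
        using norm_triangle_ineq4[of "F x" "G x"] by (intro powr_mono2) (use p in auto)
      also have "\<dots> \<le> 2 powr p * (norm (F x) powr p + norm (G x) powr p)"
        by (cases "norm (F x) \<le> norm (G x)") (auto simp: max_def powr_mult)
      finally show "norm (norm (F x - G x) powr p)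
          \<le> norm (2 powr p * (norm (F x) powr p + norm (G x) powr p))"
        by simp
    qed
  qed measurable
  then show ?thesis
    by (simp add: Lp_def)
qed

lemma (in finite_measure) bounded_in_Lp:
  assumes F: "F \<in> borel_measurable M" and p: "p > 0" and le: "\<And>x. norm (F x) \<le> B"
  shows "F \<in> Lp M p"
proof -
  have "B \<ge> 0"
    using le[of undefined] norm_ge_zero order_trans by blast
  moreover have "(\<lambda>_. 1 :: real) \<in> Lp M p"
    by (simp add: Lp_def)
  ultimately show ?thesis
    using Lp_dominated[of "\<lambda>_. 1 :: real" M p F B] F p le by simp
qed

lemma Lp_norm_nonneg: "Lp_norm M p F \<ge> 0"
  by (simp add: Lp_norm_def)

text \<open>
  Young's inequality applied to \<open>F\<close> and \<open>G\<close> divided by their norms; if one of the norms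
  vanishes, so does the product almost everywhere.
\<close>

lemma Holder_inequality:
  assumes F: "F \<in> Lp M p" and G: "G \<in> Lp M q"
    and pq: "p > 1" "q > 1" "1 / p + 1 / q = 1"
  shows "integrable M (\<lambda>x. norm (F x) * norm (G x))"
    and "(\<integral>x. norm (F x) * norm (G x) \<partial>M) \<le> Lp_norm M p F * Lp_norm M q G"
proof -
  have F_meas [measurable]: "F \<in> borel_measurable M"
    and F_int: "integrable M (\<lambda>x. norm (F x) powr p)"
    using F by (auto simp: Lp_def)
  have G_meas [measurable]: "G \<in> borel_measurable M"
    and G_int: "integrable M (\<lambda>x. norm (G x) powr q)"
    using G by (auto simp: Lp_def)
  have "integrable M (\<lambda>x. norm (F x) powr p / p + norm (G x) powr q / q)"
    using F_int G_int by simp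
  then show int: "integrable M (\<lambda>x. norm (F x) * norm (G x))"
  proof (rule Bochner_Integration.integrable_bound)
    show "AE x in M. norm (norm (F x) * norm (G x))
        \<le> norm (norm (F x) powr p / p + norm (G x) powr q / q)"
      using Youngs_inequality[OF pq] pq by (intro AE_I2) simp
  qed measurable
  define A where "A = (\<integral>x. norm (F x) powr p \<partial>M)"
  define B where "B = (\<integral>x. norm (G x) powr q \<partial>M)"
  have A0: "A \<ge> 0" and B0: "B \<ge> 0"
    by (auto simp: A_def B_def)
  define a where "a = Lp_norm M p F"
  define b where "b = Lp_norm M q G"
  show "(\<integral>x. norm (F x) * norm (G x) \<partial>M) \<le> Lp_norm M p F * Lp_norm M q G"
  proof (cases "A = 0 \<or> B = 0")
    case True
    have "AE x in M. norm (F x) powr p = 0" if "A = 0"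
      using that integral_nonneg_eq_0_iff_AE[OF F_int] by (simp add: A_def)
    moreover have "AE x in M. norm (G x) powr q = 0" if "B = 0"
      using that integral_nonneg_eq_0_iff_AE[OF G_int] by (simp add: B_def)
    ultimately have "AE x in M. norm (F x) * norm (G x) = 0"
      using True by (elim disjE) (auto elim: AE_mp)
    then have "(\<integral>x. norm (F x) * norm (G x) \<partial>M) = 0"
      by (rule integral_eq_zero_AE)
    then show ?thesis
      by (simp add: Lp_norm_nonneg)
  next
    case False
    then have "A > 0" "B > 0"
      using A0 B0 by auto
    then have "a > 0" "b > 0" and ap: "a powr p = A" and bq: "b powr q = B"
      using pq by (auto simp: a_def b_def Lp_norm_def powr_powr simp flip: A_def B_def)
    have "(\<integral>x. norm (F x) / a * (norm (G x) / b) \<partial>M)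
        \<le> (\<integral>x. norm (F x) powr p / A / p + norm (G x) powr q / B / q \<partial>M)"
    proof (rule integral_mono)
      show "integrable M (\<lambda>x. norm (F x) / a * (norm (G x) / b))"
        using int by (simp add: times_divide_times_eq)
      show "integrable M (\<lambda>x. norm (F x) powr p / A / p + norm (G x) powr q / B / q)"
        using F_int G_int by simp
      fix x
      show "norm (F x) / a * (norm (G x) / b)
          \<le> norm (F x) powr p / A / p + norm (G x) powr q / B / q"
        using Youngs_inequality[OF pq, of "norm (F x) / a" "norm (G x) / b"]
          \<open>a > 0\<close> \<open>b > 0\<close> by (simp add: powr_divide ap bq)
    qed
    also have "\<dots> = A / A / p + B / B / q"
      using F_int G_int by (simp add: A_def B_def)
    also have "\<dots> = 1"
      using \<open>A > 0\<close> \<open>B > 0\<close> pq by simp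
    finally have "(\<integral>x. norm (F x) * norm (G x) \<partial>M) / (a * b) \<le> 1"
      by (simp add: times_divide_times_eq)
    then show ?thesis
      using \<open>a > 0\<close> \<open>b > 0\<close> by (simp add: a_def b_def field_simps)
  qed
qed

text \<open>
  The limits of integrals in the integration by parts have this form: \<open>v n\<close> is the error of an approximation
  in \<open>L\<^sup>p\<close>, and the factors it is multiplied by are bounded functions times an element of the
  dual space. Lipschitz continuity of those bounded functions then replaces the passage to
  almost everywhere convergent subsequences.
\<close>

lemma tendsto_integral_Lp_dominated:
  fixes k :: "nat \<Rightarrow> 'a \<Rightarrow> real"
  assumes v: "\<And>n. v n \<in> Lp M p" and v0: "(\<lambda>n. Lp_norm M p (v n)) \<longlonglongrightarrow> 0"
    and G: "G \<in> Lp M q" and pq: "p > 1" "q > 1" "1 / p + 1 / q = 1"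
    and k_meas: "\<And>n. k n \<in> borel_measurable M" and k'_int: "integrable M k'"
    and le: "\<And>n. AE x in M. \<bar>k n x - k' x\<bar> \<le> norm (v n x) * norm (G x)"
  shows "(\<lambda>n. \<integral>x. k n x \<partial>M) \<longlonglongrightarrow> (\<integral>x. k' x \<partial>M)"
proof -
  note H = Holder_inequality[OF v G pq]
  have d_int: "integrable M (\<lambda>x. k n x - k' x)" for n
  proof (rule Bochner_Integration.integrable_bound[OF H(1)[of n]])
    show "(\<lambda>x. k n x - k' x) \<in> borel_measurable M"
      using k_meas[of n] k'_int by measurable
    show "AE x in M. norm (k n x - k' x) \<le> norm (norm (v n x) * norm (G x))"
      using le[of n] by simp
  qed
  have k_int: "integrable M (k n)" for n
    using Bochner_Integration.integrable_add[OF d_int[of n] k'_int] by simp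
  have "(\<lambda>n. (\<integral>x. k n x \<partial>M) - (\<integral>x. k' x \<partial>M)) \<longlonglongrightarrow> 0"
  proof (rule Lim_null_comparison)
    show "(\<lambda>n. Lp_norm M p (v n) * Lp_norm M q G) \<longlonglongrightarrow> 0"
      using tendsto_mult_right[OF v0, of "Lp_norm M q G"] by simp
    have "\<bar>(\<integral>x. k n x \<partial>M) - (\<integral>x. k' x \<partial>M)\<bar> \<le> Lp_norm M p (v n) * Lp_norm M q G" for n
    proof -
      have "\<bar>(\<integral>x. k n x \<partial>M) - (\<integral>x. k' x \<partial>M)\<bar> = \<bar>\<integral>x. k n x - k' x \<partial>M\<bar>"
        using k_int k'_int by simp
      also have "\<dots> \<le> (\<integral>x. \<bar>k n x - k' x\<bar> \<partial>M)"
        by (rule integral_abs_bound)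
      also have "\<dots> \<le> (\<integral>x. norm (v n x) * norm (G x) \<partial>M)"
        using le[of n] by (intro integral_mono_AE H(1) integrable_abs d_int)
      also have "\<dots> \<le> Lp_norm M p (v n) * Lp_norm M q G"
        by (rule H(2))
      finally show ?thesis .
    qed
    then show "\<forall>\<^sub>F n in sequentially. norm ((\<integral>x. k n x \<partial>M) - (\<integral>x. k' x \<partial>M))
        \<le> Lp_norm M p (v n) * Lp_norm M q G"
      by simp
  qed
  then show ?thesis
    by (simp add: LIM_zero_iff)
qed

section \<open>Smooth bounded functions\<close>

lemma grad_eqI:
  assumes "GDERIV \<phi> x :> d"
  shows "grad \<phi> x = d"
  unfolding grad_def
proof (rule the_equality)
  show "GDERIV \<phi> x :> d"
    by (rule assms)
next
  fix e assume "GDERIV \<phi> x :> e"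
  then have "(\<lambda>h. h \<bullet> e) = (\<lambda>h. h \<bullet> d)"
    using assms unfolding gderiv_def by (rule has_derivative_unique)
  then have "\<forall>h. h \<bullet> e = h \<bullet> d"
    by (rule fun_cong[THEN allI])
  then show "e = d"
    by (simp only: vector_eq_ldot)
qed

lemma Cb1_GDERIV: "\<phi> \<in> Cb1 \<Longrightarrow> GDERIV \<phi> x :> grad \<phi> x"
  using grad_eqI unfolding Cb1_def by blast

lemma Cb1_continuous: "\<phi> \<in> Cb1 \<Longrightarrow> continuous_on UNIV \<phi>"
  and Cb1_grad_continuous: "\<phi> \<in> Cb1 \<Longrightarrow> continuous_on UNIV (grad \<phi>)"
  by (auto simp: Cb1_def Cb_def)

lemma Cb1_bounds:
  assumes "\<phi> \<in> Cb1"
  shows "\<exists>A>0. \<forall>x. \<bar>\<phi> x\<bar> \<le> A \<and> norm (grad \<phi> x) \<le> A"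
proof -
  obtain B where "\<forall>x. \<bar>\<phi> x\<bar> \<le> B"
    using assms by (auto simp: Cb1_def Cb_def bounded_iff)
  moreover obtain C where "\<forall>x. norm (grad \<phi> x) \<le> C"
    using assms by (auto simp: Cb1_def bounded_iff)
  ultimately show ?thesis
    by (intro exI[of _ "max 1 (max B C)"]) (auto simp: max.coboundedI1 max.coboundedI2)
qed

lemma Cb1I:
  assumes "\<And>x. GDERIV \<phi> x :> d x" "continuous_on UNIV d"
    "\<And>x. \<bar>\<phi> x\<bar> \<le> A" "\<And>x. norm (d x) \<le> B"
  shows "\<phi> \<in> Cb1"
proof -
  have d: "grad \<phi> = d"
    using grad_eqI[OF assms(1)] by auto
  have "continuous_on UNIV \<phi>"
    using assms(1) by (auto intro!: has_derivative_continuous_on[of UNIV \<phi> "\<lambda>x h. h \<bullet> d x"]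
      simp: gderiv_def)
  moreover have "bounded (range \<phi>)" "bounded (range d)"
    using assms(3,4) by (auto simp: bounded_iff)
  ultimately show ?thesis
    unfolding Cb1_def Cb_def mem_Collect_eq d using assms(1,2) by blast
qed

lemma const_in_Cb1: "(\<lambda>_. c) \<in> Cb1"
  by (rule Cb1I[where d="\<lambda>_. 0" and A="\<bar>c\<bar>" and B=0]) (auto intro: GDERIV_const)

lemma compose_mult_in_Cb1:
  assumes \<gamma>: "\<gamma> \<in> Cb1" and \<phi>: "\<phi> \<in> Cb1"
    and \<theta>: "\<And>t. (\<theta> has_real_derivative \<theta>' t) (at t)" and \<theta>'_cont: "continuous_on UNIV \<theta>'"
    and B: "\<And>t. \<bar>\<theta> t\<bar> \<le> B" and L: "\<And>t. \<bar>\<theta>' t\<bar> \<le> L"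
  shows "(\<lambda>x. \<theta> (\<gamma> x) * \<phi> x) \<in> Cb1" (is ?C)
    and "grad (\<lambda>x. \<theta> (\<gamma> x) * \<phi> x) x
      = \<theta> (\<gamma> x) *\<^sub>R grad \<phi> x + \<phi> x *\<^sub>R \<theta>' (\<gamma> x) *\<^sub>R grad \<gamma> x" (is ?G)
proof -
  have D: "GDERIV (\<lambda>x. \<theta> (\<gamma> x) * \<phi> x) x :>
      \<theta> (\<gamma> x) *\<^sub>R grad \<phi> x + \<phi> x *\<^sub>R \<theta>' (\<gamma> x) *\<^sub>R grad \<gamma> x" for x
    by (intro GDERIV_mult GDERIV_DERIV_compose Cb1_GDERIV \<theta> \<gamma> \<phi>)
  then show ?G
    by (rule grad_eqI)
  obtain A1 where A1: "A1 > 0" "\<And>x. \<bar>\<gamma> x\<bar> \<le> A1" "\<And>x. norm (grad \<gamma> x) \<le> A1"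
    using Cb1_bounds[OF \<gamma>] by blast
  obtain A2 where A2: "A2 > 0" "\<And>x. \<bar>\<phi> x\<bar> \<le> A2" "\<And>x. norm (grad \<phi> x) \<le> A2"
    using Cb1_bounds[OF \<phi>] by blast
  have B0: "B \<ge> 0" and L0: "L \<ge> 0"
    using B[of 0] L[of 0] by auto
  have \<theta>_cont: "continuous_on UNIV \<theta>"
    using \<theta> by (auto intro: DERIV_continuous_on)
  show ?C
  proof (rule Cb1I[OF D])
    show "continuous_on UNIV (\<lambda>x. \<theta> (\<gamma> x) *\<^sub>R grad \<phi> x + \<phi> x *\<^sub>R \<theta>' (\<gamma> x) *\<^sub>R grad \<gamma> x)"
      by (intro continuous_intros Cb1_grad_continuous Cb1_continuous \<phi> \<gamma>
          continuous_on_compose2[OF \<theta>_cont] continuous_on_compose2[OF \<theta>'_cont]) auto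
    show "\<bar>\<theta> (\<gamma> x) * \<phi> x\<bar> \<le> B * A2" for x
      unfolding abs_mult by (intro mult_mono B A2 B0) auto
    show "norm (\<theta> (\<gamma> x) *\<^sub>R grad \<phi> x + \<phi> x *\<^sub>R \<theta>' (\<gamma> x) *\<^sub>R grad \<gamma> x) \<le> B * A2 + A2 * (L * A1)" for x
    proof (rule norm_triangle_mono)
      show "norm (\<theta> (\<gamma> x) *\<^sub>R grad \<phi> x) \<le> B * A2"
        unfolding norm_scaleR by (intro mult_mono B A2 B0) auto
      have "\<bar>\<phi> x\<bar> * (\<bar>\<theta>' (\<gamma> x)\<bar> * norm (grad \<gamma> x)) \<le> A2 * (L * A1)"
        using A1(1) A2(1) L0 by (intro mult_mono A2 L A1) auto
      then show "norm (\<phi> x *\<^sub>R \<theta>' (\<gamma> x) *\<^sub>R grad \<gamma> x) \<le> A2 * (L * A1)"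
        by (simp add: abs_mult mult.assoc)
    qed
  qed
qed


lemma inverse_one_plus_square_lipschitz:
  fixes a b :: real
  shows "\<bar>inverse (1 + a\<^sup>2) - inverse (1 + b\<^sup>2)\<bar> \<le> \<bar>a - b\<bar>"
proof -
  have pos: "1 + a\<^sup>2 > 0" "1 + b\<^sup>2 > 0"
    by (auto intro: add_pos_nonneg)
  have "inverse (1 + a\<^sup>2) - inverse (1 + b\<^sup>2) = (b - a) * ((a + b) / ((1 + a\<^sup>2) * (1 + b\<^sup>2)))"
    using pos by (simp add: field_simps power2_eq_square)
  moreover have "\<bar>a + b\<bar> \<le> (1 + a\<^sup>2) * (1 + b\<^sup>2)"
  proof -
    have "2 * \<bar>a\<bar> \<le> 1 + a\<^sup>2" "2 * \<bar>b\<bar> \<le> 1 + b\<^sup>2"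
      using zero_le_power2[of "\<bar>a\<bar> - 1"] zero_le_power2[of "\<bar>b\<bar> - 1"]
      by (simp_all add: power2_diff)
    moreover have "0 \<le> a\<^sup>2 * b\<^sup>2" "0 \<le> a\<^sup>2" "0 \<le> b\<^sup>2"
      by simp_all
    moreover have "(1 + a\<^sup>2) * (1 + b\<^sup>2) = 1 + a\<^sup>2 + b\<^sup>2 + a\<^sup>2 * b\<^sup>2"
      by (simp add: algebra_simps)
    ultimately show ?thesis
      using abs_triangle_ineq[of a b] by linarith
  qed
  then have "\<bar>(a + b) / ((1 + a\<^sup>2) * (1 + b\<^sup>2))\<bar> \<le> 1"
    using pos by (simp add: abs_mult)
  ultimately show ?thesis
    using mult_left_mono[of "\<bar>(a + b) / ((1 + a\<^sup>2) * (1 + b\<^sup>2))\<bar>" 1 "\<bar>b - a\<bar>"]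
    by (simp add: abs_mult abs_minus_commute)
qed

section \<open>Integration by parts along the level sets\<close>

locale gradient_closure = prob_space \<nu>
  for \<nu> :: "'a::{real_inner, polish_space} measure" +
  fixes R :: "'a \<Rightarrow> 'a" and p q :: real
  assumes sets_\<nu>: "sets \<nu> = sets borel"
    and bounded_linear_R: "bounded_linear R"
    and p: "p > 1" and q_def: "q = p / (p - 1)"
    and closable: "closable_R_grad \<nu> R p"
begin

lemma q: "q > 1" and conjugate: "1 / p + 1 / q = 1"
  using p by (auto simp: q_def field_simps)

lemma continuous_imp_measurable:
  fixes f :: "'a \<Rightarrow> 'b::topological_space"
  assumes "continuous_on UNIV f"
  shows "f \<in> borel_measurable \<nu>"
  unfolding measurable_cong_sets[OF sets_\<nu> refl]
  by (rule borel_measurable_continuous_onI[OF assms])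

lemma R_grad_continuous: "\<phi> \<in> Cb1 \<Longrightarrow> continuous_on UNIV (\<lambda>x. R (grad \<phi> x))"
  by (intro bounded_linear.continuous_on[OF bounded_linear_R] Cb1_grad_continuous)

lemma R_grad_bound:
  assumes "\<phi> \<in> Cb1"
  shows "\<exists>A>0. \<forall>x. norm (R (grad \<phi> x)) \<le> A"
proof -
  obtain A where A: "A > 0" "\<And>x. norm (grad \<phi> x) \<le> A"
    using Cb1_bounds[OF assms] by blast
  obtain K where K: "K > 0" "\<And>x. norm (R x) \<le> norm x * K"
    using bounded_linear.pos_bounded[OF bounded_linear_R] by blast
  have "norm (R (grad \<phi> x)) \<le> A * K" for x
    using K(2)[of "grad \<phi> x"] mult_right_mono[OF A(2)[of x], of K] K(1) by linarith
  then show ?thesis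
    using A(1) K(1) by (intro exI[of _ "A * K"]) simp
qed

lemma Cb1_in_Lp:
  assumes "\<phi> \<in> Cb1"
  shows "\<phi> \<in> Lp \<nu> p"
proof -
  obtain A where "\<And>x. \<bar>\<phi> x\<bar> \<le> A"
    using Cb1_bounds[OF assms] by blast
  then show ?thesis
    using p by (intro bounded_in_Lp[of _ _ A] continuous_imp_measurable Cb1_continuous assms) auto
qed

lemma R_grad_in_Lp:
  assumes "\<phi> \<in> Cb1"
  shows "(\<lambda>x. R (grad \<phi> x)) \<in> Lp \<nu> p"
proof -
  obtain A where "\<And>x. norm (R (grad \<phi> x)) \<le> A"
    using R_grad_bound[OF assms] by blast
  then show ?thesis
    using p by (intro bounded_in_Lp[of _ _ A] continuous_imp_measurable R_grad_continuous assms) auto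
qed

lemma Cb1_in_M_graph: "\<phi> \<in> Cb1 \<Longrightarrow> (\<phi>, \<lambda>x. R (grad \<phi> x)) \<in> M_graph \<nu> R p"
  unfolding M_graph_def mem_Collect_eq split
  by (intro conjI Cb1_in_Lp R_grad_in_Lp exI[of _ "\<lambda>_. \<phi>"]) (simp_all add: Lp_norm_def)

lemma M_op_in_M_graph: "f \<in> W1 \<nu> R p \<Longrightarrow> (f, M_op \<nu> R p f) \<in> M_graph \<nu> R p"
  unfolding W1_def M_op_def Domain_iff by (erule someI_ex)

lemma Cb1_in_W1: "\<phi> \<in> Cb1 \<Longrightarrow> \<phi> \<in> W1 \<nu> R p"
  unfolding W1_def by (rule DomainI) (rule Cb1_in_M_graph)

lemma M_op_Cb1:
  assumes "\<phi> \<in> Cb1"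
  shows "AE x in \<nu>. M_op \<nu> R p \<phi> x = R (grad \<phi> x)"
  using closable[unfolded closable_R_grad_def, rule_format,
      OF conjI[OF M_op_in_M_graph[OF Cb1_in_W1[OF assms]] Cb1_in_M_graph[OF assms]]] .

lemma
  assumes F: "F \<in> Lp \<nu> p" and G: "G \<in> Lp \<nu> q"
    and b: "b \<in> borel_measurable \<nu>" "\<And>x. \<bar>b x\<bar> \<le> B"
  shows integrable_weighted_inner: "integrable \<nu> (\<lambda>x. b x * (F x \<bullet> G x))"
    and weighted_inner_le:
      "\<bar>\<integral>x. b x * (F x \<bullet> G x) \<partial>\<nu>\<bar> \<le> B * (Lp_norm \<nu> p F * Lp_norm \<nu> q G)"
proof -
  note H = Holder_inequality[OF F G p q conjugate]
  have [measurable]: "F \<in> borel_measurable \<nu>" "G \<in> borel_measurable \<nu>"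
    using F G by (auto simp: Lp_def)
  note b(1) [measurable]
  have B0: "B \<ge> 0"
    using b(2)[of undefined] by linarith
  have le: "\<bar>b x * (F x \<bullet> G x)\<bar> \<le> B * (norm (F x) * norm (G x))" for x
    unfolding abs_mult by (intro mult_mono b Cauchy_Schwarz_ineq2 B0) auto
  have int: "integrable \<nu> (\<lambda>x. B * (norm (F x) * norm (G x)))"
    by (intro integrable_mult_right H(1))
  then show wint: "integrable \<nu> (\<lambda>x. b x * (F x \<bullet> G x))"
  proof (rule Bochner_Integration.integrable_bound)
    show "AE x in \<nu>. norm (b x * (F x \<bullet> G x)) \<le> norm (B * (norm (F x) * norm (G x)))"
      using le B0 by (intro AE_I2) (simp add: abs_mult)
  qed measurable
  have "\<bar>\<integral>x. b x * (F x \<bullet> G x) \<partial>\<nu>\<bar> \<le> (\<integral>x. \<bar>b x * (F x \<bullet> G x)\<bar> \<partial>\<nu>)"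
    by (rule integral_abs_bound)
  also have "\<dots> \<le> (\<integral>x. B * (norm (F x) * norm (G x)) \<partial>\<nu>)"
    by (intro integral_mono integrable_abs wint int le)
  also have "\<dots> \<le> B * (Lp_norm \<nu> p F * Lp_norm \<nu> q G)"
    using H(2) B0 by (simp add: mult_left_mono)
  finally show "\<bar>\<integral>x. b x * (F x \<bullet> G x) \<partial>\<nu>\<bar> \<le> B * (Lp_norm \<nu> p F * Lp_norm \<nu> q G)" .
qed

lemma weighted_inner_tendsto:
  assumes F: "\<And>n. F n \<in> Lp \<nu> p" and F': "F' \<in> Lp \<nu> p"
    and lim: "(\<lambda>n. Lp_norm \<nu> p (\<lambda>x. F n x - F' x)) \<longlonglongrightarrow> 0"
    and G: "G \<in> Lp \<nu> q"
    and b: "b \<in> borel_measurable \<nu>" "\<And>x. \<bar>b x\<bar> \<le> B"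
  shows "(\<lambda>n. \<integral>x. b x * (F n x \<bullet> G x) \<partial>\<nu>) \<longlonglongrightarrow> (\<integral>x. b x * (F' x \<bullet> G x) \<partial>\<nu>)"
proof (rule tendsto_integral_Lp_dominated[OF _ lim _ p q conjugate])
  have [measurable]: "G \<in> borel_measurable \<nu>"
    using G by (auto simp: Lp_def)
  have B0: "B \<ge> 0"
    using b(2)[of undefined] by linarith
  show "(\<lambda>x. F n x - F' x) \<in> Lp \<nu> p" for n
    using Lp_diff[OF F F'] p by simp
  show "(\<lambda>x. B *\<^sub>R G x) \<in> Lp \<nu> q"
    using q B0 by (intro Lp_dominated[OF G, of _ B]) auto
  show "(\<lambda>x. b x * (F n x \<bullet> G x)) \<in> borel_measurable \<nu>" for n
    using integrable_weighted_inner[OF F G b] by (rule borel_measurable_integrable)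
  show "integrable \<nu> (\<lambda>x. b x * (F' x \<bullet> G x))"
    by (rule integrable_weighted_inner[OF F' G b])
  show "AE x in \<nu>. \<bar>b x * (F n x \<bullet> G x) - b x * (F' x \<bullet> G x)\<bar>
      \<le> norm (F n x - F' x) * norm (B *\<^sub>R G x)" for n
  proof (rule AE_I2)
    fix x
    have "\<bar>b x * (F n x \<bullet> G x) - b x * (F' x \<bullet> G x)\<bar> = \<bar>b x\<bar> * \<bar>(F n x - F' x) \<bullet> G x\<bar>"
      by (simp add: abs_mult inner_diff_left flip: right_diff_distrib)
    also have "\<dots> \<le> B * (norm (F n x - F' x) * norm (G x))"
      by (intro mult_mono b Cauchy_Schwarz_ineq2 B0) auto
    finally show "\<bar>b x * (F n x \<bullet> G x) - b x * (F' x \<bullet> G x)\<bar>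
        \<le> norm (F n x - F' x) * norm (B *\<^sub>R G x)"
      using B0 by (simp add: algebra_simps)
  qed
qed

end

text \<open>
  The field \<open>\<Psi>\<close> stands for \<open>Mg / \<parallel>Mg\<parallel>\<^sup>2\<close>, seen through two of its properties: it is in the
  domain of the adjoint, and it is dual to \<open>Mg\<close>. The second one makes \<open>\<theta>'(g)\<close> appear without a gradient factor.
\<close>

locale level_function = gradient_closure +
  fixes g :: "'a \<Rightarrow> real" and Mg \<Psi> :: "'a \<Rightarrow> 'a" and h :: "'a \<Rightarrow> real"
  assumes g_graph: "(g, Mg) \<in> M_graph \<nu> R p"
    and \<Psi>_adjoint: "(\<Psi>, h) \<in> M_adj_graph \<nu> R p"
    and Mg_\<Psi>: "AE x in \<nu>. Mg x \<bullet> \<Psi> x = 1"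
begin

lemma g_in_Lp: "g \<in> Lp \<nu> p" and Mg_in_Lp: "Mg \<in> Lp \<nu> p"
  using g_graph by (auto simp: M_graph_def)

lemma \<Psi>_in_Lp: "\<Psi> \<in> Lp \<nu> q" and h_in_Lp: "h \<in> Lp \<nu> q"
  using \<Psi>_adjoint by (auto simp: M_adj_graph_def q_def)

lemma g_measurable [measurable]: "g \<in> borel_measurable \<nu>"
  using g_in_Lp by (simp add: Lp_def)

lemma adjoint_Cb1:
  assumes \<phi>: "\<phi> \<in> Cb1"
  shows "(\<integral>x. R (grad \<phi> x) \<bullet> \<Psi> x \<partial>\<nu>) = (\<integral>x. \<phi> x * h x \<partial>\<nu>)"
proof -
  note W = Cb1_in_W1[OF \<phi>]
  have [measurable]: "M_op \<nu> R p \<phi> \<in> borel_measurable \<nu>" "\<Psi> \<in> borel_measurable \<nu>"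
      "(\<lambda>x. R (grad \<phi> x)) \<in> borel_measurable \<nu>"
    using M_op_in_M_graph[OF W] \<Psi>_in_Lp R_grad_in_Lp[OF \<phi>] by (auto simp: M_graph_def Lp_def)
  have "(\<integral>x. R (grad \<phi> x) \<bullet> \<Psi> x \<partial>\<nu>) = (\<integral>x. M_op \<nu> R p \<phi> x \<bullet> \<Psi> x \<partial>\<nu>)"
    using M_op_Cb1[OF \<phi>] by (intro integral_cong_AE) auto
  also have "\<dots> = (\<integral>x. \<phi> x * h x \<partial>\<nu>)"
    using \<Psi>_adjoint W by (auto simp: M_adj_graph_def)
  finally show ?thesis .
qed

text \<open>
  The product \<open>\<theta> (g) \<phi>\<close> need not be smooth. With \<open>g\<close> replaced by smooth approximations
  \<open>\<gamma> n\<close> it is an admissible test function, and the limit is then taken in the integrals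
  of the adjoint relation rather than in the graph of \<open>M\<close>.
\<close>

lemma integration_by_parts_Cb1:
  assumes \<phi>: "\<phi> \<in> Cb1"
    and \<theta>: "\<And>t. (\<theta> has_real_derivative \<theta>' t) (at t)"
    and B: "\<And>t. \<bar>\<theta> t\<bar> \<le> B" and L: "\<And>t. \<bar>\<theta>' t\<bar> \<le> L"
    and K: "\<And>s t. \<bar>\<theta>' s - \<theta>' t\<bar> \<le> K * \<bar>s - t\<bar>"
  shows "(\<integral>x. \<theta>' (g x) * \<phi> x \<partial>\<nu>)
    = (\<integral>x. \<theta> (g x) * (\<phi> x * h x) \<partial>\<nu>) - (\<integral>x. \<theta> (g x) * (R (grad \<phi> x) \<bullet> \<Psi> x) \<partial>\<nu>)"
proof -
  obtain \<gamma> where \<gamma>: "\<And>n. \<gamma> n \<in> Cb1"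
    and \<gamma>_lim: "(\<lambda>n. Lp_norm \<nu> p (\<lambda>x. \<gamma> n x - g x)) \<longlonglongrightarrow> 0"
    and R\<gamma>_lim: "(\<lambda>n. Lp_norm \<nu> p (\<lambda>x. R (grad (\<gamma> n) x) - Mg x)) \<longlonglongrightarrow> 0"
    using g_graph by (auto simp: M_graph_def)
  obtain A where A: "A > 0" "\<And>x. \<bar>\<phi> x\<bar> \<le> A"
    using Cb1_bounds[OF \<phi>] by blast
  obtain A' where A': "A' > 0" "\<And>x. norm (R (grad \<phi> x)) \<le> A'"
    using R_grad_bound[OF \<phi>] by blast
  have L0: "L \<ge> 0"
    using L[of 0] by linarith
  have K0: "K \<ge> 0"
    using K[of 1 0] by simp
  have \<theta>_lip: "\<bar>\<theta> s - \<theta> t\<bar> \<le> L * \<bar>s - t\<bar>" for s t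
    using field_differentiable_bound[of UNIV \<theta> \<theta>' L s t] \<theta> L by simp
  have \<theta>_cont: "continuous_on UNIV \<theta>"
    using \<theta> by (auto intro: DERIV_continuous_on)
  have "K-lipschitz_on UNIV \<theta>'"
    using K K0 by (auto simp: lipschitz_on_def dist_real_def)
  then have \<theta>'_cont: "continuous_on UNIV \<theta>'"
    by (rule lipschitz_on_continuous_on)
  have [measurable]: "\<theta> \<in> borel_measurable borel" "\<theta>' \<in> borel_measurable borel"
    using \<theta>_cont \<theta>'_cont by (auto intro: borel_measurable_continuous_onI)
  have [measurable]: "\<gamma> n \<in> borel_measurable \<nu>" "(\<lambda>x. R (grad (\<gamma> n) x)) \<in> borel_measurable \<nu>" for n
    by (auto intro: continuous_imp_measurable Cb1_continuous R_grad_continuous \<gamma>)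
  have [measurable]: "\<phi> \<in> borel_measurable \<nu>" "(\<lambda>x. R (grad \<phi> x)) \<in> borel_measurable \<nu>"
    by (auto intro: continuous_imp_measurable Cb1_continuous R_grad_continuous \<phi>)
  have [measurable]: "Mg \<in> borel_measurable \<nu>" "\<Psi> \<in> borel_measurable \<nu>" "h \<in> borel_measurable \<nu>"
    using Mg_in_Lp \<Psi>_in_Lp h_in_Lp by (auto simp: Lp_def)
  have v_Lp: "(\<lambda>x. \<gamma> n x - g x) \<in> Lp \<nu> p" for n
    using Lp_diff[OF Cb1_in_Lp[OF \<gamma>] g_in_Lp] p by simp
  have w_Lp: "(\<lambda>x. R (grad (\<gamma> n) x) - Mg x) \<in> Lp \<nu> p" for n
    using Lp_diff[OF R_grad_in_Lp[OF \<gamma>] Mg_in_Lp] p by simp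
  have \<theta>'\<phi>: "\<bar>\<theta>' t * \<phi> x\<bar> \<le> L * A" for t x
    unfolding abs_mult by (intro mult_mono L A L0) auto
  note real_inner = integrable_weighted_inner[where 'b=real, unfolded inner_real_def]
  \<comment> \<open>The adjoint relation for the admissible test function \<open>\<theta> (\<gamma> n) \<phi>\<close>.\<close>
  have eq: "(\<integral>x. \<theta>' (\<gamma> n x) * \<phi> x * ((R (grad (\<gamma> n) x) - Mg x) \<bullet> \<Psi> x) \<partial>\<nu>)
      + (\<integral>x. \<theta>' (\<gamma> n x) * \<phi> x * (Mg x \<bullet> \<Psi> x) \<partial>\<nu>)
      = (\<integral>x. \<theta> (\<gamma> n x) * (\<phi> x * h x) \<partial>\<nu>) - (\<integral>x. \<theta> (\<gamma> n x) * (R (grad \<phi> x) \<bullet> \<Psi> x) \<partial>\<nu>)"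
    for n
  proof -
    note C = compose_mult_in_Cb1[OF \<gamma>[of n] \<phi> \<theta> \<theta>'_cont B L]
    have i1: "integrable \<nu> (\<lambda>x. \<theta>' (\<gamma> n x) * \<phi> x * ((R (grad (\<gamma> n) x) - Mg x) \<bullet> \<Psi> x))"
      by (rule integrable_weighted_inner[OF w_Lp \<Psi>_in_Lp _ \<theta>'\<phi>]) measurable
    have i2: "integrable \<nu> (\<lambda>x. \<theta>' (\<gamma> n x) * \<phi> x * (Mg x \<bullet> \<Psi> x))"
      by (rule integrable_weighted_inner[OF Mg_in_Lp \<Psi>_in_Lp _ \<theta>'\<phi>]) measurable
    have i3: "integrable \<nu> (\<lambda>x. \<theta> (\<gamma> n x) * (R (grad \<phi> x) \<bullet> \<Psi> x))"
      by (rule integrable_weighted_inner[OF R_grad_in_Lp[OF \<phi>] \<Psi>_in_Lp _ B]) measurable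
    have R_grad: "R (grad (\<lambda>x. \<theta> (\<gamma> n x) * \<phi> x) x)
        = \<theta> (\<gamma> n x) *\<^sub>R R (grad \<phi> x) + (\<theta>' (\<gamma> n x) * \<phi> x) *\<^sub>R R (grad (\<gamma> n) x)" for x
      unfolding C(2) by (simp add: linear_add[OF bounded_linear.linear[OF bounded_linear_R]]
          linear_scale[OF bounded_linear.linear[OF bounded_linear_R]] mult.commute)
    have "(\<integral>x. \<theta> (\<gamma> n x) * (\<phi> x * h x) \<partial>\<nu>)
        = (\<integral>x. R (grad (\<lambda>x. \<theta> (\<gamma> n x) * \<phi> x) x) \<bullet> \<Psi> x \<partial>\<nu>)"
      using adjoint_Cb1[OF C(1)] by (simp add: mult.assoc)
    also have "\<dots> = (\<integral>x. \<theta>' (\<gamma> n x) * \<phi> x * ((R (grad (\<gamma> n) x) - Mg x) \<bullet> \<Psi> x)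
        + \<theta>' (\<gamma> n x) * \<phi> x * (Mg x \<bullet> \<Psi> x) + \<theta> (\<gamma> n x) * (R (grad \<phi> x) \<bullet> \<Psi> x) \<partial>\<nu>)"
      unfolding R_grad by (intro Bochner_Integration.integral_cong refl)
        (simp add: inner_add_left inner_diff_left algebra_simps)
    also have "\<dots> = (\<integral>x. \<theta>' (\<gamma> n x) * \<phi> x * ((R (grad (\<gamma> n) x) - Mg x) \<bullet> \<Psi> x) \<partial>\<nu>)
        + (\<integral>x. \<theta>' (\<gamma> n x) * \<phi> x * (Mg x \<bullet> \<Psi> x) \<partial>\<nu>)
        + (\<integral>x. \<theta> (\<gamma> n x) * (R (grad \<phi> x) \<bullet> \<Psi> x) \<partial>\<nu>)"
      by (simp only: Bochner_Integration.integral_add i1 i2 i3 Bochner_Integration.integrable_add)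
    finally show ?thesis
      by simp
  qed
  have lim1: "(\<lambda>n. \<integral>x. \<theta>' (\<gamma> n x) * \<phi> x * ((R (grad (\<gamma> n) x) - Mg x) \<bullet> \<Psi> x) \<partial>\<nu>)
      \<longlonglongrightarrow> (\<integral>x. 0 \<partial>\<nu>)"
  proof (rule tendsto_integral_Lp_dominated[OF w_Lp R\<gamma>_lim _ p q conjugate])
    show "(\<lambda>x. (L * A) *\<^sub>R \<Psi> x) \<in> Lp \<nu> q"
      using q L0 A(1) by (intro Lp_dominated[OF \<Psi>_in_Lp, of _ "L * A"]) auto
    show "AE x in \<nu>. \<bar>\<theta>' (\<gamma> n x) * \<phi> x * ((R (grad (\<gamma> n) x) - Mg x) \<bullet> \<Psi> x) - 0\<bar>
        \<le> norm (R (grad (\<gamma> n) x) - Mg x) * norm ((L * A) *\<^sub>R \<Psi> x)" for n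
    proof (rule AE_I2)
      fix x
      have "\<bar>\<theta>' (\<gamma> n x) * \<phi> x\<bar> * \<bar>(R (grad (\<gamma> n) x) - Mg x) \<bullet> \<Psi> x\<bar>
          \<le> L * A * (norm (R (grad (\<gamma> n) x) - Mg x) * norm (\<Psi> x))"
        using L0 A(1) by (intro mult_mono \<theta>'\<phi> Cauchy_Schwarz_ineq2) auto
      then show "\<bar>\<theta>' (\<gamma> n x) * \<phi> x * ((R (grad (\<gamma> n) x) - Mg x) \<bullet> \<Psi> x) - 0\<bar>
          \<le> norm (R (grad (\<gamma> n) x) - Mg x) * norm ((L * A) *\<^sub>R \<Psi> x)"
        using L0 A(1) by (simp add: abs_mult mult_ac)
    qed
  qed auto
  \<comment> \<open>Since \<open>Mg \<bullet> \<Psi> = 1\<close>, the error here is bounded, not merely in \<open>L\<^sup>q\<close>, times \<open>\<gamma> n - g\<close>.\<close>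
  have lim2: "(\<lambda>n. \<integral>x. \<theta>' (\<gamma> n x) * \<phi> x * (Mg x \<bullet> \<Psi> x) \<partial>\<nu>)
      \<longlonglongrightarrow> (\<integral>x. \<theta>' (g x) * \<phi> x * (Mg x \<bullet> \<Psi> x) \<partial>\<nu>)"
  proof (rule tendsto_integral_Lp_dominated[OF v_Lp \<gamma>_lim _ p q conjugate])
    show "(\<lambda>x. K * A) \<in> Lp \<nu> q"
      using q by (intro bounded_in_Lp[of _ _ "\<bar>K * A\<bar>"]) auto
    show "integrable \<nu> (\<lambda>x. \<theta>' (g x) * \<phi> x * (Mg x \<bullet> \<Psi> x))"
      by (rule integrable_weighted_inner[OF Mg_in_Lp \<Psi>_in_Lp _ \<theta>'\<phi>]) measurable
    show "AE x in \<nu>. \<bar>\<theta>' (\<gamma> n x) * \<phi> x * (Mg x \<bullet> \<Psi> x) - \<theta>' (g x) * \<phi> x * (Mg x \<bullet> \<Psi> x)\<bar>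
        \<le> norm (\<gamma> n x - g x) * norm (K * A)" for n
      using Mg_\<Psi>
    proof eventually_elim
      case (elim x)
      have "\<bar>\<theta>' (\<gamma> n x) - \<theta>' (g x)\<bar> * \<bar>\<phi> x\<bar> \<le> K * \<bar>\<gamma> n x - g x\<bar> * A"
        using K0 by (intro mult_mono K A) auto
      then have "\<bar>(\<theta>' (\<gamma> n x) - \<theta>' (g x)) * \<phi> x\<bar> \<le> \<bar>\<gamma> n x - g x\<bar> * (K * A)"
        by (simp only: abs_mult mult_ac)
      then show ?case
        using K0 A(1) by (simp add: elim left_diff_distrib abs_mult)
    qed
  qed auto
  have lim3: "(\<lambda>n. \<integral>x. \<theta> (\<gamma> n x) * (\<phi> x * h x) \<partial>\<nu>) \<longlonglongrightarrow> (\<integral>x. \<theta> (g x) * (\<phi> x * h x) \<partial>\<nu>)"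
  proof (rule tendsto_integral_Lp_dominated[OF v_Lp \<gamma>_lim _ p q conjugate])
    show "(\<lambda>x. (L * A) *\<^sub>R h x) \<in> Lp \<nu> q"
      using q L0 A(1) by (intro Lp_dominated[OF h_in_Lp, of _ "L * A"]) (auto simp: abs_mult)
    show "integrable \<nu> (\<lambda>x. \<theta> (g x) * (\<phi> x * h x))"
      by (rule real_inner[OF Cb1_in_Lp[OF \<phi>] h_in_Lp _ B]) measurable
    show "AE x in \<nu>. \<bar>\<theta> (\<gamma> n x) * (\<phi> x * h x) - \<theta> (g x) * (\<phi> x * h x)\<bar>
        \<le> norm (\<gamma> n x - g x) * norm ((L * A) *\<^sub>R h x)" for n
    proof (rule AE_I2)
      fix x
      have "\<bar>\<theta> (\<gamma> n x) - \<theta> (g x)\<bar> * (\<bar>\<phi> x\<bar> * \<bar>h x\<bar>) \<le> L * \<bar>\<gamma> n x - g x\<bar> * (A * \<bar>h x\<bar>)"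
        using L0 A(1) by (intro mult_mono \<theta>_lip A) auto
      then show "\<bar>\<theta> (\<gamma> n x) * (\<phi> x * h x) - \<theta> (g x) * (\<phi> x * h x)\<bar>
          \<le> norm (\<gamma> n x - g x) * norm ((L * A) *\<^sub>R h x)"
        unfolding left_diff_distrib[symmetric] using L0 A(1) by (simp add: abs_mult mult_ac)
    qed
  qed auto
  have lim4: "(\<lambda>n. \<integral>x. \<theta> (\<gamma> n x) * (R (grad \<phi> x) \<bullet> \<Psi> x) \<partial>\<nu>)
      \<longlonglongrightarrow> (\<integral>x. \<theta> (g x) * (R (grad \<phi> x) \<bullet> \<Psi> x) \<partial>\<nu>)"
  proof (rule tendsto_integral_Lp_dominated[OF v_Lp \<gamma>_lim _ p q conjugate])
    show "(\<lambda>x. (L * A') *\<^sub>R \<Psi> x) \<in> Lp \<nu> q"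
      using q L0 A'(1) by (intro Lp_dominated[OF \<Psi>_in_Lp, of _ "L * A'"]) auto
    show "integrable \<nu> (\<lambda>x. \<theta> (g x) * (R (grad \<phi> x) \<bullet> \<Psi> x))"
      by (rule integrable_weighted_inner[OF R_grad_in_Lp[OF \<phi>] \<Psi>_in_Lp _ B]) measurable
    show "AE x in \<nu>. \<bar>\<theta> (\<gamma> n x) * (R (grad \<phi> x) \<bullet> \<Psi> x) - \<theta> (g x) * (R (grad \<phi> x) \<bullet> \<Psi> x)\<bar>
        \<le> norm (\<gamma> n x - g x) * norm ((L * A') *\<^sub>R \<Psi> x)" for n
    proof (rule AE_I2)
      fix x
      have "\<bar>R (grad \<phi> x) \<bullet> \<Psi> x\<bar> \<le> A' * norm (\<Psi> x)"
        using Cauchy_Schwarz_ineq2[of "R (grad \<phi> x)" "\<Psi> x"]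
          mult_right_mono[OF A'(2)[of x] norm_ge_zero[of "\<Psi> x"]] by linarith
      then have "\<bar>\<theta> (\<gamma> n x) - \<theta> (g x)\<bar> * \<bar>R (grad \<phi> x) \<bullet> \<Psi> x\<bar>
          \<le> L * \<bar>\<gamma> n x - g x\<bar> * (A' * norm (\<Psi> x))"
        using L0 by (intro mult_mono \<theta>_lip) auto
      then show "\<bar>\<theta> (\<gamma> n x) * (R (grad \<phi> x) \<bullet> \<Psi> x) - \<theta> (g x) * (R (grad \<phi> x) \<bullet> \<Psi> x)\<bar>
          \<le> norm (\<gamma> n x - g x) * norm ((L * A') *\<^sub>R \<Psi> x)"
        unfolding left_diff_distrib[symmetric] using L0 A'(1) by (simp add: abs_mult mult_ac)
    qed
  qed auto
  have "(\<integral>x. 0 \<partial>\<nu>) + (\<integral>x. \<theta>' (g x) * \<phi> x * (Mg x \<bullet> \<Psi> x) \<partial>\<nu>)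
      = (\<integral>x. \<theta> (g x) * (\<phi> x * h x) \<partial>\<nu>) - (\<integral>x. \<theta> (g x) * (R (grad \<phi> x) \<bullet> \<Psi> x) \<partial>\<nu>)"
    using tendsto_add[OF lim1 lim2] unfolding eq
    by (rule LIMSEQ_unique) (rule tendsto_diff[OF lim3 lim4])
  moreover have "(\<integral>x. \<theta>' (g x) * \<phi> x * (Mg x \<bullet> \<Psi> x) \<partial>\<nu>) = (\<integral>x. \<theta>' (g x) * \<phi> x \<partial>\<nu>)"
    using Mg_\<Psi> by (intro integral_cong_AE) auto
  ultimately show ?thesis
    by simp
qed

lemma integration_by_parts:
  assumes f: "(f, Mf) \<in> M_graph \<nu> R p"
    and \<theta>: "\<And>t. (\<theta> has_real_derivative \<theta>' t) (at t)"
    and B: "\<And>t. \<bar>\<theta> t\<bar> \<le> B" and L: "\<And>t. \<bar>\<theta>' t\<bar> \<le> L"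
    and K: "\<And>s t. \<bar>\<theta>' s - \<theta>' t\<bar> \<le> K * \<bar>s - t\<bar>"
  shows "(\<integral>x. \<theta>' (g x) * f x \<partial>\<nu>)
    = (\<integral>x. \<theta> (g x) * (f x * h x) \<partial>\<nu>) - (\<integral>x. \<theta> (g x) * (Mf x \<bullet> \<Psi> x) \<partial>\<nu>)"
proof -
  obtain \<phi> where \<phi>: "\<And>n. \<phi> n \<in> Cb1"
    and \<phi>_lim: "(\<lambda>n. Lp_norm \<nu> p (\<lambda>x. \<phi> n x - f x)) \<longlonglongrightarrow> 0"
    and R\<phi>_lim: "(\<lambda>n. Lp_norm \<nu> p (\<lambda>x. R (grad (\<phi> n) x) - Mf x)) \<longlonglongrightarrow> 0"
    and f_Lp: "f \<in> Lp \<nu> p" and Mf_Lp: "Mf \<in> Lp \<nu> p"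
    using f by (auto simp: M_graph_def)
  have K0: "K \<ge> 0"
    using K[of 1 0] by simp
  have \<theta>_cont: "continuous_on UNIV \<theta>"
    using \<theta> by (auto intro: DERIV_continuous_on)
  have "K-lipschitz_on UNIV \<theta>'"
    using K K0 by (auto simp: lipschitz_on_def dist_real_def)
  then have \<theta>'_cont: "continuous_on UNIV \<theta>'"
    by (rule lipschitz_on_continuous_on)
  have [measurable]: "\<theta> \<in> borel_measurable borel" "\<theta>' \<in> borel_measurable borel"
    using \<theta>_cont \<theta>'_cont by (auto intro: borel_measurable_continuous_onI)
  have one: "(\<lambda>_. 1 :: real) \<in> Lp \<nu> q"
    using q by (intro bounded_in_Lp[of _ _ 1]) auto
  have l1: "(\<lambda>n. \<integral>x. \<theta>' (g x) * \<phi> n x \<partial>\<nu>) \<longlonglongrightarrow> (\<integral>x. \<theta>' (g x) * f x \<partial>\<nu>)"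
    using weighted_inner_tendsto[OF Cb1_in_Lp[OF \<phi>] f_Lp \<phi>_lim one _ L, of g] by simp
  have l2: "(\<lambda>n. \<integral>x. \<theta> (g x) * (\<phi> n x * h x) \<partial>\<nu>) \<longlonglongrightarrow> (\<integral>x. \<theta> (g x) * (f x * h x) \<partial>\<nu>)"
    using weighted_inner_tendsto[OF Cb1_in_Lp[OF \<phi>] f_Lp \<phi>_lim h_in_Lp _ B, of g] by simp
  have l3: "(\<lambda>n. \<integral>x. \<theta> (g x) * (R (grad (\<phi> n) x) \<bullet> \<Psi> x) \<partial>\<nu>)
      \<longlonglongrightarrow> (\<integral>x. \<theta> (g x) * (Mf x \<bullet> \<Psi> x) \<partial>\<nu>)"
    using weighted_inner_tendsto[OF R_grad_in_Lp[OF \<phi>] Mf_Lp R\<phi>_lim \<Psi>_in_Lp _ B, of g] by simp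
  show ?thesis
    using l1 unfolding integration_by_parts_Cb1[OF \<phi> \<theta> B L K]
    by (rule LIMSEQ_unique) (rule tendsto_diff[OF l2 l3])
qed


text \<open>
  Integration by parts with \<open>\<theta> t = arctan ((t - r) / \<delta>)\<close>. This function is bounded
  independently of \<open>\<delta>\<close>, and its derivative is at least \<open>1 / (2 * \<delta>)\<close> on a strip of width
  \<open>\<delta>\<close> next to \<open>r\<close>; so the mass of \<open>f\<close> on the strip, divided by the width, is controlled by
  the Sobolev norm of \<open>f\<close> uniformly in \<open>\<delta>\<close>.
\<close>

lemma level_strip_le:
  assumes f: "f \<in> W1 \<nu> R p" and f0: "AE x in \<nu>. f x \<ge> 0" and \<delta>: "\<delta> > 0"
  shows "(\<integral>x. indicator {r<..r + \<delta>} (g x) * f x \<partial>\<nu>)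
    \<le> \<delta> * (pi * (Lp_norm \<nu> q h + Lp_norm \<nu> q \<Psi>) * W1_norm \<nu> R p f)"
proof -
  define \<theta> where "\<theta> t = arctan ((t - r) / \<delta>)" for t
  define \<theta>' where "\<theta>' t = inverse (1 + ((t - r) / \<delta>)\<^sup>2) / \<delta>" for t
  note graph = M_op_in_M_graph[OF f]
  then have f_Lp: "f \<in> Lp \<nu> p" and Mf_Lp: "M_op \<nu> R p f \<in> Lp \<nu> p"
    by (auto simp: M_graph_def)
  have [measurable]: "\<theta> \<in> borel_measurable borel" "\<theta>' \<in> borel_measurable borel"
    unfolding \<theta>_def \<theta>'_def by measurable
  have [measurable]: "f \<in> borel_measurable \<nu>"
    using f_Lp by (simp add: Lp_def)
  have \<theta>: "(\<theta> has_real_derivative \<theta>' t) (at t)" for t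
  proof -
    have "((\<lambda>t. arctan ((t - r) / \<delta>)) has_real_derivative
        inverse (1 + ((t - r) / \<delta>)\<^sup>2) * (1 / \<delta>)) (at t)"
      by (rule DERIV_chain2[OF DERIV_arctan]) (use \<delta> in \<open>auto intro!: derivative_eq_intros\<close>)
    then show ?thesis
      unfolding \<theta>_def[abs_def] \<theta>'_def by (simp only: times_divide_eq_right mult_1_right)
  qed
  have B: "\<bar>\<theta> t\<bar> \<le> pi / 2" for t
    unfolding \<theta>_def using arctan_lbound[of "(t - r) / \<delta>"] arctan_ubound[of "(t - r) / \<delta>"] by linarith
  have L: "\<bar>\<theta>' t\<bar> \<le> 1 / \<delta>" for t
  proof -
    have "0 < 1 + ((t - r) / \<delta>)\<^sup>2"
      by (rule add_pos_nonneg) auto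
    then have "\<bar>inverse (1 + ((t - r) / \<delta>)\<^sup>2)\<bar> \<le> 1"
      by (simp add: inverse_le_1_iff)
    then show ?thesis
      unfolding \<theta>'_def abs_divide using \<delta> by (simp add: divide_right_mono)
  qed
  have K: "\<bar>\<theta>' s - \<theta>' t\<bar> \<le> (1 / \<delta>\<^sup>2) * \<bar>s - t\<bar>" for s t
  proof -
    have "\<bar>\<theta>' s - \<theta>' t\<bar> = \<bar>inverse (1 + ((s - r) / \<delta>)\<^sup>2) - inverse (1 + ((t - r) / \<delta>)\<^sup>2)\<bar> / \<delta>"
      unfolding \<theta>'_def diff_divide_distrib[symmetric] using \<delta> by (simp only: abs_divide abs_of_pos)
    also have "\<dots> \<le> \<bar>(s - r) / \<delta> - (t - r) / \<delta>\<bar> / \<delta>"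
      using \<delta> by (intro divide_right_mono inverse_one_plus_square_lipschitz) simp
    also have "\<dots> = (1 / \<delta>\<^sup>2) * \<bar>s - t\<bar>"
      using \<delta> unfolding diff_divide_distrib[symmetric] by (simp add: abs_divide power2_eq_square)
    finally show ?thesis .
  qed
  define N where "N = Lp_norm \<nu> p f * Lp_norm \<nu> q h + Lp_norm \<nu> p (M_op \<nu> R p f) * Lp_norm \<nu> q \<Psi>"
  have "(\<integral>x. \<theta>' (g x) * f x \<partial>\<nu>) \<le> pi / 2 * N"
  proof -
    have "\<bar>\<integral>x. \<theta> (g x) * (f x * h x) \<partial>\<nu>\<bar> \<le> pi / 2 * (Lp_norm \<nu> p f * Lp_norm \<nu> q h)"
      using weighted_inner_le[OF f_Lp h_in_Lp _ B, of g] by simp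
    moreover have "\<bar>\<integral>x. \<theta> (g x) * (M_op \<nu> R p f x \<bullet> \<Psi> x) \<partial>\<nu>\<bar>
        \<le> pi / 2 * (Lp_norm \<nu> p (M_op \<nu> R p f) * Lp_norm \<nu> q \<Psi>)"
      using weighted_inner_le[OF Mf_Lp \<Psi>_in_Lp _ B, of g] by simp
    ultimately show ?thesis
      unfolding integration_by_parts[OF graph \<theta> B L K] N_def distrib_left by linarith
  qed
  moreover have "(\<integral>x. indicator {r<..r + \<delta>} (g x) * f x \<partial>\<nu>) \<le> (\<integral>x. 2 * \<delta> * (\<theta>' (g x) * f x) \<partial>\<nu>)"
  proof (rule integral_mono_AE)
    have one: "(\<lambda>_. 1 :: real) \<in> Lp \<nu> q"
      using q by (intro bounded_in_Lp[of _ _ 1]) auto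
    show "integrable \<nu> (\<lambda>x. indicator {r<..r + \<delta>} (g x) * f x)"
      using integrable_weighted_inner[OF f_Lp one, of "\<lambda>x. indicator {r<..r + \<delta>} (g x)" 1] by simp
    show "integrable \<nu> (\<lambda>x. 2 * \<delta> * (\<theta>' (g x) * f x))"
      using integrable_weighted_inner[OF f_Lp one _ L, of g] by simp
    show "AE x in \<nu>. indicator {r<..r + \<delta>} (g x) * f x \<le> 2 * \<delta> * (\<theta>' (g x) * f x)"
      using f0
    proof eventually_elim
      case (elim x)
      have "indicator {r<..r + \<delta>} (g x) \<le> 2 * \<delta> * \<theta>' (g x)"
      proof (cases "g x \<in> {r<..r + \<delta>}")
        case True
        then have "\<bar>(g x - r) / \<delta>\<bar> \<le> 1"
          using \<delta> by simp
        then have "((g x - r) / \<delta>)\<^sup>2 \<le> 1"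
          by (simp add: abs_square_le_1)
        then have inv: "inverse 2 \<le> inverse (1 + ((g x - r) / \<delta>)\<^sup>2)"
          by (intro le_imp_inverse_le) (auto intro: add_pos_nonneg)
        have "1 \<le> 2 * inverse (1 + ((g x - r) / \<delta>)\<^sup>2)"
          using mult_left_mono[OF inv, of 2] by simp
        moreover have "2 * \<delta> * \<theta>' (g x) = 2 * inverse (1 + ((g x - r) / \<delta>)\<^sup>2)"
          using \<delta> by (simp add: \<theta>'_def)
        ultimately show ?thesis
          using True by simp
      next
        case False
        then show ?thesis
          using \<delta> by (simp add: \<theta>'_def)
      qed
      then show ?case
        using elim mult_right_mono by (fastforce simp: mult.assoc)
    qed
  qed
  moreover have "N \<le> (Lp_norm \<nu> q h + Lp_norm \<nu> q \<Psi>) * W1_norm \<nu> R p f"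
  proof -
    have "0 \<le> Lp_norm \<nu> q \<Psi> * Lp_norm \<nu> p f + Lp_norm \<nu> q h * Lp_norm \<nu> p (M_op \<nu> R p f)"
      by (intro add_nonneg_nonneg mult_nonneg_nonneg Lp_norm_nonneg)
    then show ?thesis
      unfolding N_def W1_norm_def by (simp add: algebra_simps)
  qed
  then have "\<delta> * (pi * N) \<le> \<delta> * (pi * ((Lp_norm \<nu> q h + Lp_norm \<nu> q \<Psi>) * W1_norm \<nu> R p f))"
    using \<delta> by (intro mult_left_mono) auto
  moreover have "(\<integral>x. 2 * \<delta> * (\<theta>' (g x) * f x) \<partial>\<nu>) = 2 * \<delta> * (\<integral>x. \<theta>' (g x) * f x \<partial>\<nu>)"
    by simp
  moreover have "2 * \<delta> * (\<integral>x. \<theta>' (g x) * f x \<partial>\<nu>) \<le> 2 * \<delta> * (pi / 2 * N)"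
    using calculation(1) \<delta> by (intro mult_left_mono) auto
  ultimately show ?thesis
    by (simp add: mult.assoc)
qed


text \<open>
  The difference quotients from the right of \<open>s \<mapsto> \<integral>\<^bsub>{g \<le> s}\<^esub> \<phi> d\<nu>\<close> are averages over
  thin strips, so a comparison of \<open>\<phi>\<close> with \<open>f\<close> on one strip suffices.
\<close>

lemma surface_integral_le:
  assumes \<sigma>: "is_surface_measure \<nu> g r \<sigma>"
    and \<phi>: "\<phi> \<in> Cb"
    and f: "f \<in> W1 \<nu> R p" and f0: "AE x in \<nu>. f x \<ge> 0"
    and \<eta>: "\<eta> > 0" and le: "AE x in \<nu>. r < g x \<and> g x \<le> r + \<eta> \<longrightarrow> \<phi> x \<le> f x"
  shows "(\<integral>x. \<phi> x \<partial>\<sigma>) \<le> pi * (Lp_norm \<nu> q h + Lp_norm \<nu> q \<Psi>) * W1_norm \<nu> R p f" (is "_ \<le> ?C")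
proof -
  define F where "F s = (LINT x:{x. g x \<le> s}|\<nu>. \<phi> x)" for s
  have "(F has_real_derivative (\<integral>x. \<phi> x \<partial>\<sigma>)) (at r)"
    using \<sigma> \<phi> unfolding is_surface_measure_def F_def by blast
  then have lim: "((\<lambda>d. (F (r + d) - F r) / d) \<longlongrightarrow> (\<integral>x. \<phi> x \<partial>\<sigma>)) (at_right 0)"
    unfolding DERIV_def by (rule filterlim_mono[OF _ order_refl]) (simp add: at_le)
  have \<phi>_cont: "continuous_on UNIV \<phi>" and \<phi>_bdd: "bounded (range \<phi>)"
    using \<phi> by (auto simp: Cb_def)
  have [measurable]: "\<phi> \<in> borel_measurable \<nu>"
    by (rule continuous_imp_measurable[OF \<phi>_cont])
  obtain A where A: "\<And>x. \<bar>\<phi> x\<bar> \<le> A"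
    using \<phi>_bdd by (auto simp: bounded_iff)
  have \<phi>_Lp: "\<phi> \<in> Lp \<nu> p"
    using p A by (intro bounded_in_Lp[of _ _ A]) auto
  have f_Lp: "f \<in> Lp \<nu> p"
    using f by (auto simp: W1_def M_graph_def)
  have one: "(\<lambda>_. 1 :: real) \<in> Lp \<nu> q"
    using q by (intro bounded_in_Lp[of _ _ 1]) auto
  have int: "integrable \<nu> (\<lambda>x. indicator S (g x) * u x)"
    if "S \<in> sets borel" "u \<in> Lp \<nu> p" for S :: "real set" and u :: "'a \<Rightarrow> real"
    using that integrable_weighted_inner[OF that(2) one, of "\<lambda>x. indicator S (g x)" 1] by simp
  have F: "F s = (\<integral>x. indicator {..s} (g x) * \<phi> x \<partial>\<nu>)" for s
    unfolding F_def set_lebesgue_integral_def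
    by (intro Bochner_Integration.integral_cong) (auto simp: indicator_def)
  have quotient_le: "(F (r + d) - F r) / d \<le> ?C" if d: "0 < d" "d \<le> \<eta>" for d
  proof -
    have "F (r + d) - F r = (\<integral>x. indicator {..r + d} (g x) * \<phi> x - indicator {..r} (g x) * \<phi> x \<partial>\<nu>)"
      unfolding F by (intro Bochner_Integration.integral_diff[symmetric] int \<phi>_Lp) auto
    also have "\<dots> = (\<integral>x. indicator {r<..r + d} (g x) * \<phi> x \<partial>\<nu>)"
      using d by (intro Bochner_Integration.integral_cong) (auto simp: indicator_def)
    also have "\<dots> \<le> (\<integral>x. indicator {r<..r + d} (g x) * f x \<partial>\<nu>)"
    proof (intro integral_mono_AE int \<phi>_Lp f_Lp)
      show "AE x in \<nu>. indicator {r<..r + d} (g x) * \<phi> x \<le> indicator {r<..r + d} (g x) * f x"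
        using le by eventually_elim (use d in \<open>auto simp: indicator_def\<close>)
    qed auto
    also have "\<dots> \<le> d * ?C"
      using level_strip_le[OF f f0 d(1)] by simp
    finally show ?thesis
      using d(1) by (simp add: divide_le_eq mult.commute)
  qed
  have "\<forall>\<^sub>F d in at_right 0. (F (r + d) - F r) / d \<le> ?C"
    unfolding eventually_at_right[OF \<eta>] by (intro exI[of _ \<eta>]) (auto simp: \<eta> quotient_le)
  then show ?thesis
    by (intro tendsto_upperbound[OF lim]) auto
qed

end

section \<open>Exceptional sets of small capacity\<close>

lemma measure_open_le_of_Cb:
  fixes \<sigma> :: "'a::metric_space measure"
  assumes "finite_measure \<sigma>" and sets_\<sigma>: "sets \<sigma> = sets borel" and D: "open D"
    and le: "\<And>\<phi>. \<phi> \<in> Cb \<Longrightarrow> (\<And>x. 0 \<le> \<phi> x \<and> \<phi> x \<le> indicator D x) \<Longrightarrow> (\<integral>x. \<phi> x \<partial>\<sigma>) \<le> c"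
  shows "measure \<sigma> D \<le> c"
proof -
  interpret finite_measure \<sigma> by fact
  have space: "space \<sigma> = UNIV"
    using sets_eq_imp_space_eq[OF sets_\<sigma>] by simp
  have D_sets: "D \<in> sets \<sigma>"
    using D sets_\<sigma> by simp
  show ?thesis
  proof (cases "D = UNIV")
    case True
    then show ?thesis
      using le[of "\<lambda>_. 1"] by (simp add: Cb_def space)
  next
    case False
    \<comment> \<open>The case \<open>D = UNIV\<close> is separate because the distance to the empty set is 0.\<close>
    define \<phi> where "\<phi> k x = min 1 (real k * infdist x (- D))" for k x
    have \<phi>_cont: "continuous_on UNIV (\<phi> k)" for k
      unfolding \<phi>_def by (intro continuous_intros)
    have \<phi>_nonneg: "0 \<le> \<phi> k x" for k x
      by (simp add: \<phi>_def infdist_nonneg)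
    have \<phi>_le_1: "\<phi> k x \<le> 1" for k x
      by (simp add: \<phi>_def)
    have \<phi>_outside: "\<phi> k x = 0" if "x \<notin> D" for k x
      using that by (simp add: \<phi>_def)
    have "bounded (range (\<phi> k))" for k
      unfolding bounded_iff using \<phi>_nonneg \<phi>_le_1 by (intro exI[of _ 1]) auto
    then have int_le: "(\<integral>x. \<phi> k x \<partial>\<sigma>) \<le> c" for k
      using \<phi>_cont \<phi>_nonneg \<phi>_le_1 \<phi>_outside by (intro le) (auto simp: Cb_def indicator_def)
    have "(\<lambda>k. \<integral>x. \<phi> k x \<partial>\<sigma>) \<longlonglongrightarrow> (\<integral>x. indicator D x \<partial>\<sigma>)"
    proof (rule integral_dominated_convergence[where w="\<lambda>_. 1"])
      show "\<phi> k \<in> borel_measurable \<sigma>" for k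
        unfolding measurable_cong_sets[OF sets_\<sigma> refl]
        by (rule borel_measurable_continuous_onI[OF \<phi>_cont])
      show "AE x in \<sigma>. (\<lambda>k. \<phi> k x) \<longlonglongrightarrow> indicator D x"
      proof (rule AE_I2)
        fix x
        show "(\<lambda>k. \<phi> k x) \<longlonglongrightarrow> indicator D x"
        proof (cases "x \<in> D")
          case True
          then have pos: "infdist x (- D) > 0"
            using D False infdist_pos_not_in_closed[of "- D" x] by (auto simp: closed_Compl)
          obtain m where m: "1 < real m * infdist x (- D)"
            using reals_Archimedean3[OF pos] by blast
          have "\<phi> k x = 1" if "k \<ge> m" for k
          proof -
            have "real m * infdist x (- D) \<le> real k * infdist x (- D)"
              using that pos by (intro mult_right_mono) auto
            then show ?thesis
              using m by (simp add: \<phi>_def)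
          qed
          then show ?thesis
            using True by (intro tendsto_eventually) (auto simp: eventually_sequentially)
        qed (simp add: \<phi>_outside)
      qed
      show "AE x in \<sigma>. norm (\<phi> k x) \<le> 1" for k
        using \<phi>_nonneg \<phi>_le_1 by auto
    qed (use D_sets in auto)
    then have "(\<integral>x. indicator D x \<partial>\<sigma>) \<le> c"
      using int_le by (intro LIMSEQ_le_const2) auto
    then show ?thesis
      using D_sets by (simp add: space)
  qed
qed

context level_function
begin

text \<open>
  The sets \<open>D \<eta>\<close> in the proof are open although \<open>gstar\<close> is continuous only on the complement
  of \<open>U\<close>, since they contain \<open>U\<close>. The bound on their measure comes from \<open>surface_integral_le\<close>
  on a strip of width \<open>\<eta>\<close>, with \<open>f\<close> a Sobolev function nearly optimal for the capacity of
  \<open>U\<close>. The threshold \<open>\<eta> > 0\<close> is what separates the set from the level \<open>r\<close>.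
\<close>

lemma small_open_superset:
  assumes \<sigma>: "is_surface_measure \<nu> g r \<sigma>"
    and gstar: "AE x in \<nu>. gstar x = g x"
    and U: "open U" "capacity \<nu> R p U < \<epsilon>" "continuous_on (- U) gstar"
  shows "\<exists>D. open D \<and> - (gstar -` {r}) \<subseteq> D
    \<and> measure \<sigma> D \<le> pi * (Lp_norm \<nu> q h + Lp_norm \<nu> q \<Psi>) * \<epsilon>"
proof -
  have fin: "finite_measure \<sigma>" and sets_\<sigma>: "sets \<sigma> = sets borel"
    using \<sigma> by (auto simp: is_surface_measure_def)
  interpret \<sigma>: finite_measure \<sigma> by (rule fin)
  have ne: "{W1_norm \<nu> R p f | f. f \<in> W1 \<nu> R p \<and> (AE x in \<nu>. f x \<ge> indicator U x)} \<noteq> {}"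
    using Cb1_in_W1[OF const_in_Cb1[of 1]] by (auto simp: indicator_def intro!: exI[of _ "\<lambda>_. 1"])
  obtain f where f: "f \<in> W1 \<nu> R p" and f_U: "AE x in \<nu>. f x \<ge> indicator U x"
    and f_norm: "W1_norm \<nu> R p f < \<epsilon>"
    using cInf_lessD[OF ne] U(2) unfolding capacity_def by blast
  have f0: "AE x in \<nu>. f x \<ge> 0"
    using f_U by eventually_elim (rule order_trans[OF indicator_pos_le])
  define c where "c = pi * (Lp_norm \<nu> q h + Lp_norm \<nu> q \<Psi>)"
  have c0: "c \<ge> 0"
    unfolding c_def by (intro mult_nonneg_nonneg add_nonneg_nonneg Lp_norm_nonneg) auto
  define D where "D \<eta> = U \<union> {x. \<eta> < \<bar>gstar x - r\<bar>}" for \<eta>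
  have open_D: "open (D \<eta>)" for \<eta>
  proof -
    have "open {t. \<eta> < \<bar>t - r\<bar>}"
      by (intro open_Collect_less continuous_intros)
    then obtain A where A: "open A" "A \<inter> - U = gstar -` {t. \<eta> < \<bar>t - r\<bar>} \<inter> - U"
      using U(3) unfolding continuous_on_open_invariant by blast
    then have "D \<eta> = U \<union> A"
      unfolding D_def by blast
    then show ?thesis
      using open_Un[OF U(1) A(1)] by simp
  qed
  have D_le: "measure \<sigma> (D \<eta>) \<le> c * \<epsilon>" if \<eta>: "\<eta> > 0" for \<eta>
  proof (rule measure_open_le_of_Cb[OF fin sets_\<sigma> open_D])
    fix \<phi> :: "'a \<Rightarrow> real"
    assume \<phi>: "\<phi> \<in> Cb" and \<phi>_le: "\<And>x. 0 \<le> \<phi> x \<and> \<phi> x \<le> indicator (D \<eta>) x"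
    have "(\<integral>x. \<phi> x \<partial>\<sigma>) \<le> c * W1_norm \<nu> R p f"
      unfolding c_def
    proof (rule surface_integral_le[OF \<sigma> \<phi> f f0 \<eta>])
      show "AE x in \<nu>. r < g x \<and> g x \<le> r + \<eta> \<longrightarrow> \<phi> x \<le> f x"
        using gstar f_U
      proof eventually_elim
        case (elim x)
        show ?case
        proof
          assume "r < g x \<and> g x \<le> r + \<eta>"
          then have "indicator (D \<eta>) x = (indicator U x :: real)"
            using elim(1) by (auto simp: D_def indicator_def)
          then show "\<phi> x \<le> f x"
            using \<phi>_le[of x] elim(2) by simp
        qed
      qed
    qed
    also have "\<dots> \<le> c * \<epsilon>"
      using f_norm c0 by (intro mult_left_mono) auto
    finally show "(\<integral>x. \<phi> x \<partial>\<sigma>) \<le> c * \<epsilon>" .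
  qed
  have union: "(\<Union>n. D (1 / real (Suc n))) = D 0"
  proof
    show "D 0 \<subseteq> (\<Union>n. D (1 / real (Suc n)))"
    proof
      fix x assume x: "x \<in> D 0"
      show "x \<in> (\<Union>n. D (1 / real (Suc n)))"
      proof (cases "x \<in> U")
        case False
        then have "0 < \<bar>gstar x - r\<bar>"
          using x by (simp add: D_def)
        then obtain n where "1 / real (Suc n) < \<bar>gstar x - r\<bar>"
          using nat_approx_posE by blast
        then show ?thesis
          by (auto simp: D_def)
      qed (auto simp: D_def)
    qed
    show "(\<Union>n. D (1 / real (Suc n))) \<subseteq> D 0"
    proof -
      have "D (1 / real (Suc n)) \<subseteq> D 0" for n
        unfolding D_def using order_less_trans[of 0 "1 / real (Suc n)"] by auto
      then show ?thesis
        by blast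
    qed
  qed
  have "(\<lambda>n. measure \<sigma> (D (1 / real (Suc n)))) \<longlonglongrightarrow> measure \<sigma> (\<Union>n. D (1 / real (Suc n)))"
  proof (rule \<sigma>.finite_Lim_measure_incseq)
    show "range (\<lambda>n. D (1 / real (Suc n))) \<subseteq> sets \<sigma>"
      using open_D sets_\<sigma> by auto
    show "incseq (\<lambda>n. D (1 / real (Suc n)))"
    proof (rule incseq_SucI)
      fix n
      have "1 / real (Suc (Suc n)) < 1 / real (Suc n)"
        by (simp add: divide_simps)
      then show "D (1 / real (Suc n)) \<subseteq> D (1 / real (Suc (Suc n)))"
        unfolding D_def by (auto intro: order_less_trans)
    qed
  qed
  then have "measure \<sigma> (D 0) \<le> c * \<epsilon>"
    unfolding union by (rule LIMSEQ_le_const2) (intro exI allI impI D_le, simp)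
  moreover have "- (gstar -` {r}) \<subseteq> D 0"
    by (auto simp: D_def)
  ultimately show ?thesis
    using open_D[of 0] unfolding c_def by blast
qed

lemma quasicontinuous_level_set_complement_null:
  assumes \<sigma>: "is_surface_measure \<nu> g r \<sigma>"
    and gstar: "AE x in \<nu>. gstar x = g x" and qc: "quasicontinuous \<nu> R p gstar"
  shows "\<exists>N \<in> null_sets \<sigma>. - (gstar -` {r}) \<subseteq> N"
proof -
  have fin: "finite_measure \<sigma>" and sets_\<sigma>: "sets \<sigma> = sets borel"
    using \<sigma> by (auto simp: is_surface_measure_def)
  interpret \<sigma>: finite_measure \<sigma> by (rule fin)
  define c where "c = pi * (Lp_norm \<nu> q h + Lp_norm \<nu> q \<Psi>)"
  have "\<exists>D. open D \<and> - (gstar -` {r}) \<subseteq> D \<and> measure \<sigma> D \<le> c * (1 / real (Suc n))" for n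
  proof -
    have "0 < 1 / real (Suc n)"
      by simp
    then obtain U where "open U" "capacity \<nu> R p U < 1 / real (Suc n)" "continuous_on (- U) gstar"
      using qc unfolding quasicontinuous_def by blast
    then show ?thesis
      unfolding c_def by (rule small_open_superset[OF \<sigma> gstar])
  qed
  then obtain D where D: "\<And>n. open (D n)" "\<And>n. - (gstar -` {r}) \<subseteq> D n"
      "\<And>n. measure \<sigma> (D n) \<le> c * (1 / real (Suc n))"
    by metis
  define N where "N = (\<Inter>n. D n)"
  have N_sets: "N \<in> sets \<sigma>"
    unfolding N_def sets_\<sigma> using D(1) by (intro sets.countable_INT) auto
  have "measure \<sigma> N \<le> c * (1 / real (Suc n))" for n
  proof -
    have "measure \<sigma> N \<le> measure \<sigma> (D n)"
      using D(1) sets_\<sigma> by (intro \<sigma>.finite_measure_mono) (auto simp: N_def)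
    then show ?thesis
      using D(3)[of n] by linarith
  qed
  moreover have "(\<lambda>n. c * (1 / real (Suc n))) \<longlonglongrightarrow> c * 0"
    by (intro tendsto_mult_left) (use LIMSEQ_inverse_real_of_nat in \<open>simp add: inverse_eq_divide\<close>)
  ultimately have "measure \<sigma> N \<le> c * 0"
    by (intro LIMSEQ_le_const) auto
  then have "emeasure \<sigma> N = 0"
    using measure_nonneg[of \<sigma> N] by (simp add: \<sigma>.emeasure_eq_measure)
  then have "N \<in> null_sets \<sigma>"
    using N_sets by (rule null_setsI)
  moreover have "- (gstar -` {r}) \<subseteq> N"
    unfolding N_def using D(2) by blast
  ultimately show ?thesis
    by blast
qed

end

theorem proposition4p5:
  fixes \<nu> :: "'a::{real_inner, polish_space} measure"
    and R :: "'a \<Rightarrow> 'a"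
    and g gstar :: "'a \<Rightarrow> real"
    and p\<^sub>0 r\<^sub>0 :: real
    and \<sigma> :: "'a measure"
  assumes "infinite_dimensional TYPE('a)"
    and "prob_space \<nu>" and "sets \<nu> = sets borel" and "nondegenerate \<nu>"
    and "bounded_linear R"
    and "\<And>p. p > 1 \<Longrightarrow> closable_R_grad \<nu> R p"
    and "g \<in> borel_measurable borel"
    and "\<And>p. p > 1 \<Longrightarrow> g \<in> W1 \<nu> R p"
    and "\<And>p. p > 1 \<Longrightarrow> (AE x in \<nu>. M_op \<nu> R p g x \<noteq> 0)"
    and "\<And>p. p > 1 \<Longrightarrow>
           (\<lambda>x. M_op \<nu> R p g x /\<^sub>R (norm (M_op \<nu> R p g x))\<^sup>2) \<in> M_adj_dom \<nu> R p"
    and "p\<^sub>0 > 1" and "quasicontinuous \<nu> R p\<^sub>0 gstar" and "AE x in \<nu>. gstar x = g x"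
    and "is_surface_measure \<nu> g r\<^sub>0 \<sigma>"
  shows "\<exists>N \<in> null_sets \<sigma>. - (gstar -` {r\<^sub>0}) \<subseteq> N"
proof -
  define Mg where "Mg = M_op \<nu> R p\<^sub>0 g"
  define \<Psi> where "\<Psi> x = Mg x /\<^sub>R (norm (Mg x))\<^sup>2" for x
  have "\<Psi> \<in> M_adj_dom \<nu> R p\<^sub>0"
    using assms(10)[OF \<open>p\<^sub>0 > 1\<close>] unfolding \<Psi>_def[abs_def] Mg_def .
  then obtain h where h: "(\<Psi>, h) \<in> M_adj_graph \<nu> R p\<^sub>0"
    unfolding M_adj_dom_def by blast
  interpret gradient_closure \<nu> R p\<^sub>0 "p\<^sub>0 / (p\<^sub>0 - 1)"
    using assms by (simp add: gradient_closure_def gradient_closure_axioms_def)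
  interpret level_function \<nu> R p\<^sub>0 "p\<^sub>0 / (p\<^sub>0 - 1)" g Mg \<Psi> h
  proof
    show "(g, Mg) \<in> M_graph \<nu> R p\<^sub>0"
      unfolding Mg_def by (rule M_op_in_M_graph[OF assms(8)[OF \<open>p\<^sub>0 > 1\<close>]])
    show "(\<Psi>, h) \<in> M_adj_graph \<nu> R p\<^sub>0"
      by (rule h)
    show "AE x in \<nu>. Mg x \<bullet> \<Psi> x = 1"
      using assms(9)[OF \<open>p\<^sub>0 > 1\<close>] unfolding Mg_def[symmetric]
      by eventually_elim (simp add: \<Psi>_def power2_norm_eq_inner)
  qed
  show ?thesis
    by (rule quasicontinuous_level_set_complement_null[OF assms(14) assms(13) assms(12)])
qed

end
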